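(* Let $r\ge1$ and let $a_1,\dots,a_r$ be indeterminates. For every $j\in[0,r+1]$, every entry of the matrix $P_j(\{a\})$ defined below is a polynomial in $a_1,\dots,a_r$. Consequently the limit $P_j:=\lim_{a_1,\dots,a_r\to0}P_j(\{a\})$ is well defined.
   Context: For $i\in[1,r]$ and nonzero $a,b,c$, let $U_i(a,b,c)$ (resp. $V_i(a,b,c)$) be the $(r+1)\times(r+1)$ matrix equal to the identity except that its $2\times2$ block in rows and columns $i,i+1$ is $\begin{pmatrix}1&0\\ c/b& a/b\end{pmatrix}$ (resp. $\begin{pmatrix}b/c& a/c\\ 0&1\end{pmatrix}$). Define the array $(a_{i,-j})_{i,j\in[0,r+1]}$ of rational functions in $a_1,\dots,a_r$ by $a_{i,0}=1$ ($i\in[0,r+1]$), $a_{0,-j}=a_{r+1,-j}=1$ ($j\in[0,r+1]$), $a_{i,-1}=a_i$ ($i\in[1,r]$), and $a_{i-1,-j}a_{i+1,-j}+a_{i,-j-1}a_{i,-j+1}=0$ for $i,j\in[1,r]$ (this determines all entries recursively, and they are nonzero). For $i\in[1,r]$ and $k\in[-r,0]$ set $N_{i,k}(\{a\})=U_i(a_{i,k-1},a_{i,k},a_{i+1,k-1})$ if $i+k$ is odd and $N_{i,k}(\{a\})=V_i(a_{i-1,k},a_{i,k-1},a_{i,k})$ if $i+k$ is even. For $j\in[0,r+1]$ define $P_j(\{a\})=\prod_{k=-j+1}^{0}\big(N_{1,k}(\{a\})N_{2,k}(\{a\})\cdots N_{r,k}(\{a\})\big)$, the factors being ordered left to right by increasing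 $k$ (and $P_0(\{a\})$ is the identity). *)

theory Defs
  imports
    "HOL-Analysis.Function_Topology"
    "HOL-Library.Poly_Mapping"
    "HOL-Computational_Algebra.Polynomial_Factorial"
    "Jordan_Normal_Form.Matrix"
begin

text \<open>Polynomials in indeterminates indexed by \<open>nat\<close> (an exponent vector is a finitely
  supported function \<open>nat \<Rightarrow>\<^sub>0 nat\<close>), and their field of fractions.\<close>

type_synonym 'k mpol = "(nat \<Rightarrow>\<^sub>0 nat) \<Rightarrow>\<^sub>0 'k"
type_synonym 'k ratfun = "'k mpol fract"

definition indet :: "nat \<Rightarrow> 'k::field ratfun" where
  "indet i = to_fract (Poly_Mapping.single (Poly_Mapping.single i 1) 1)"

definition polynomials_in :: "nat set \<Rightarrow> 'k::field ratfun set" where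
  "polynomials_in I = to_fract ` {p. \<forall>m\<in>Poly_Mapping.keys p. Poly_Mapping.keys m \<subseteq> I}"

text \<open>The construction is carried out over an arbitrary field with parameters \<open>x i\<close> in place of
  \<open>a\<^sub>i\<close>: taking \<open>x = indet\<close> gives the matrices of rational functions, taking numbers
  \<open>x 1, \<dots>, x r \<noteq> 0\<close> gives their values at that point.

  The entry with indices \<open>(i, -j)\<close> of the array is \<open>array r x i j\<close>. The relation
  \<open>a\<^bsub>i-1,-j\<^esub> a\<^bsub>i+1,-j\<^esub> + a\<^bsub>i,-j-1\<^esub> a\<^bsub>i,-j+1\<^esub> = 0\<close> is solved for its entry of
  lowest second index; see \<open>array_relation\<close> and \<open>array_unique\<close> below.\<close>

fun array :: "nat \<Rightarrow> (nat \<Rightarrow> 'a::field) \<Rightarrow> nat \<Rightarrow> nat \<Rightarrow> 'a" where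
  "array r x i 0 = 1"
| "array r x i (Suc 0) = (if i \<in> {1..r} then x i else 1)"
| "array r x i (Suc (Suc j)) =
     (if i \<in> {1..r}
      then - (array r x (i - 1) (Suc j) * array r x (i + 1) (Suc j)) / array r x i j
      else 1)"

text \<open>Matrix indices of type \<open>'a mat\<close> start at 0, so rows and columns \<open>i, i+1\<close> are
  \<open>i - 1, i\<close> here.\<close>

definition id_with_block :: "nat \<Rightarrow> nat \<Rightarrow> 'a \<Rightarrow> 'a \<Rightarrow> 'a \<Rightarrow> 'a \<Rightarrow> 'a::field mat" where
  "id_with_block r i p q s t = mat (r + 1) (r + 1) (\<lambda>(m, n).
     if (m, n) = (i - 1, i - 1) then p
     else if (m, n) = (i - 1, i) then q
     else if (m, n) = (i, i - 1) then s
     else if (m, n) = (i, i) then t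
     else if m = n then 1 else 0)"

definition U_mat :: "nat \<Rightarrow> nat \<Rightarrow> 'a \<Rightarrow> 'a \<Rightarrow> 'a \<Rightarrow> 'a::field mat" where
  "U_mat r i a b c = id_with_block r i
      1       0
     (c / b) (a / b)"

definition V_mat :: "nat \<Rightarrow> nat \<Rightarrow> 'a \<Rightarrow> 'a \<Rightarrow> 'a \<Rightarrow> 'a::field mat" where
  "V_mat r i a b c = id_with_block r i
     (b / c) (a / c)
      0       1"

text \<open>\<open>N_mat r x i l\<close> is \<open>N\<^bsub>i,k\<^esub>\<close> for \<open>k = -l\<close>.\<close>

definition N_mat :: "nat \<Rightarrow> (nat \<Rightarrow> 'a::field) \<Rightarrow> nat \<Rightarrow> nat \<Rightarrow> 'a mat" where
  "N_mat r x i l =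
     (if odd (i + l)
      then U_mat r i (array r x i (l + 1)) (array r x i l) (array r x (i + 1) (l + 1))
      else V_mat r i (array r x (i - 1) l) (array r x i (l + 1)) (array r x i l))"

definition ordered_prod :: "nat \<Rightarrow> 'a::field mat list \<Rightarrow> 'a mat" where
  "ordered_prod n Ms = foldr (*) Ms (1\<^sub>m n)"

text \<open>Increasing \<open>k = -j+1, \<dots>, 0\<close> means decreasing \<open>l = j-1, \<dots>, 0\<close>.\<close>

definition P_mat :: "nat \<Rightarrow> (nat \<Rightarrow> 'a::field) \<Rightarrow> nat \<Rightarrow> 'a mat" where
  "P_mat r x j = ordered_prod (r + 1)
     (map (\<lambda>l. ordered_prod (r + 1) (map (\<lambda>i. N_mat r x i l) [1..<r + 1])) (rev [0..<j]))"

lemma indet_nonzero: "indet i \<noteq> (0 :: 'k::field ratfun)"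
proof -
  have "Poly_Mapping.single (Poly_Mapping.single i (1::nat)) (1::'k) \<noteq> 0"
    by (metis lookup_single_eq lookup_zero zero_neq_one)
  then show ?thesis by (simp add: indet_def)
qed

lemma array_boundary: "i \<notin> {1..r} \<Longrightarrow> array r x i j = 1"
  by (cases "(r, x, i, j)" rule: array.cases) auto

lemma array_nonzero:
  assumes "\<And>i. i \<in> {1..r} \<Longrightarrow> x i \<noteq> 0"
  shows "array r x i j \<noteq> 0"
  using assms by (induction r x i j rule: array.induct) auto

lemma array_relation:
  assumes "\<And>i. i \<in> {1..r} \<Longrightarrow> x i \<noteq> 0" and "i \<in> {1..r}" and "j \<ge> 1"
  shows "array r x (i - 1) j * array r x (i + 1) j + array r x i (j + 1) * array r x i (j - 1) = 0"
proof -
  obtain j' where "j = Suc j'" using \<open>j \<ge> 1\<close> by (cases j) auto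
  moreover have "array r x i j' \<noteq> 0" by (rule array_nonzero) (rule assms(1))
  ultimately show ?thesis using assms(2) by simp
qed

lemma array_unique:
  fixes x :: "nat \<Rightarrow> 'a::field"
  assumes nz: "\<And>i. i \<in> {1..r} \<Longrightarrow> x i \<noteq> 0"
    and top: "\<And>i. i \<le> r + 1 \<Longrightarrow> A i 0 = 1"
    and bdry: "\<And>j. j \<le> r + 1 \<Longrightarrow> A 0 j = 1 \<and> A (r + 1) j = 1"
    and init: "\<And>i. i \<in> {1..r} \<Longrightarrow> A i 1 = x i"
    and rel: "\<And>i j. i \<in> {1..r} \<Longrightarrow> j \<in> {1..r} \<Longrightarrow>
      A (i - 1) j * A (i + 1) j + A i (j + 1) * A i (j - 1) = 0"
    and "i \<le> r + 1" and "j \<le> r + 1"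
  shows "A i j = array r x i j"
  using \<open>i \<le> r + 1\<close> \<open>j \<le> r + 1\<close>
proof (induction j arbitrary: i rule: less_induct)
  case (less j)
  consider "j = 0" | "i = 0 \<or> i = r + 1" | "j = 1" "i \<in> {1..r}"
    | l where "j = Suc (Suc l)" "i \<in> {1..r}"
  proof -
    have i: "i = 0 \<or> i = r + 1 \<or> i \<in> {1..r}" using less.prems by auto
    have j: "j = 0 \<or> j = 1 \<or> (\<exists>l. j = Suc (Suc l))" by presburger
    show thesis using i j that by blast
  qed
  then show ?case
  proof cases
    case 1
    then show ?thesis using top less.prems by simp
  next
    case 2
    then show ?thesis using bdry[OF less.prems(2)] array_boundary[of i r x j] by auto
  next
    case 3
    then show ?thesis using init by simp
  next
    case 4
    have IH: "A (i - 1) (Suc l) = array r x (i - 1) (Suc l)"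
      "A (i + 1) (Suc l) = array r x (i + 1) (Suc l)" "A i l = array r x i l"
      using less.IH less.prems 4 by auto
    have n: "array r x i l \<noteq> 0" by (rule array_nonzero) (rule nz)
    have "A (i - 1) (Suc l) * A (i + 1) (Suc l) + A i j * A i l = 0"
      using rel[of i "Suc l"] less.prems 4 by auto
    then have "A i j * array r x i l
        = - (array r x (i - 1) (Suc l) * array r x (i + 1) (Suc l))"
      unfolding IH by (metis add.commute eq_neg_iff_add_eq_0)
    then have "A i j = - (array r x (i - 1) (Suc l) * array r x (i + 1) (Suc l)) / array r x i l"
      by (metis n nonzero_eq_divide_eq)
    then show ?thesis using 4 by simp
  qed
qed

end

theory Submission
  imports Defs
begin

text \<open>
  The array satisfies a multiplicative wave equation, so it has the d'Alembert form
  \<open>a\<^bsub>i,-t\<^esub> = \<sigma> t * f (i + t) / f (i - t)\<close> with signs \<open>\<sigma>\<close> of period 4 and a function \<open>f\<close> on the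
  integers that is reflected, up to signs, at \<open>0\<close> and at \<open>r + 1\<close>; each value of \<open>f\<close> is up to sign a
  product \<open>a\<^sub>k a\<^bsub>k-2\<^esub> a\<^bsub>k-4\<^esub> \<dots>\<close>.

  Passing from \<open>P\<^sub>l\<close> to \<open>P\<^bsub>l+1\<^esub>\<close> changes only the rows \<open>i\<close> (counted from 0) with \<open>i + l\<close> odd. Writing
  \<open>R i (l + 1)\<close> for the row \<open>i\<close> so obtained, one gets a linear recurrence expressing \<open>R i (l + 1)\<close>
  through \<open>R (i - 1) l\<close>, \<open>R i (l - 1)\<close> and \<open>R (i + 1) l\<close>. Its solution is
  \<open>R i t = c i t * (w restricted to an interval of columns)\<close> with \<open>c i t = \<sigma> t * f (i + t + 1) / f (i - t)\<close>
  and a vector \<open>w\<close> independent of \<open>i\<close> and \<open>t\<close>: the three coefficients of the recurrence carry the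
  neighbouring \<open>c\<close> to \<open>c i (l + 1)\<close>, \<open>- c i (l + 1)\<close>, \<open>c i (l + 1)\<close>, so that what remains is the
  additive wave equation for the indicator function of the interval. On that interval the
  quotients of values of \<open>f\<close> cancel, so each entry is \<open>0\<close> or up to sign a squarefree monomial.
\<close>

section \<open>Signs, the d'Alembert function and the row data\<close>

definition period4_sign :: "int \<Rightarrow> 'a::ring_1" where
  "period4_sign t = (if t mod 4 < 2 then 1 else - 1)"

lemma period4_sign_0 [simp]: "period4_sign 0 = 1"
  and period4_sign_1 [simp]: "period4_sign 1 = 1"
  by (simp_all add: period4_sign_def)

lemma period4_sign_square [simp]: "period4_sign t * period4_sign t = 1"
  by (simp add: period4_sign_def)

lemma period4_sign_square_left [simp]: "period4_sign t * (period4_sign t * a) = a"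
  by (simp add: period4_sign_def)

lemma period4_sign_nonzero [simp]: "period4_sign t \<noteq> (0 :: 'a::field)"
  by (simp add: period4_sign_def)

lemma period4_sign_plus_1: "period4_sign (t + 1) = - period4_sign (t - 1)"
proof -
  have "(t + 1) mod 4 < 2 \<longleftrightarrow> \<not> (t - 1) mod 4 < 2" by presburger
  then show ?thesis by (simp add: period4_sign_def)
qed

lemma of_int_period4_sign [simp]: "of_int (period4_sign t) = period4_sign t"
  by (simp add: period4_sign_def)

text \<open>This is \<open>x (m - 1) * x (m - 3) * ...\<close>, ending at \<open>x 1\<close> or
  \<open>x 2\<close>. The shift by one makes
  \<open>skip_prod x (i + 1) / skip_prod x (i - 1)\<close> equal to \<open>x i\<close>, as the array
  requires for \<open>j = 1\<close>.\<close>

fun skip_prod :: "(nat \<Rightarrow> 'a::comm_ring_1) \<Rightarrow> nat \<Rightarrow> 'a" where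
  "skip_prod x 0 = 1"
| "skip_prod x (Suc 0) = 1"
| "skip_prod x (Suc (Suc k)) = x (Suc k) * skip_prod x k"

lemma skip_prod_add:
  "skip_prod x (p + 2 * d) = (\<Prod>k<d. x (p + 2 * k + 1)) * skip_prod x p"
  by (induction d) (simp_all add: mult_ac)

text \<open>The signs of the reflections are chosen such that
  \<open>period4_sign t * wave r x (i + t) / wave r x (i - t)\<close> equals \<open>1\<close> for \<open>i = 0\<close> and for
  \<open>i = r + 1\<close>.\<close>

definition wave :: "nat \<Rightarrow> (nat \<Rightarrow> 'a::field) \<Rightarrow> int \<Rightarrow> 'a" where
  "wave r x m =
     (if m < 0 then period4_sign (- m) * skip_prod x (nat (- m))
      else if m \<le> int r + 1 then skip_prod x (nat m)
      else period4_sign (m - (int r + 1)) * skip_prod x (nat (2 * (int r + 1) - m)))"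

text \<open>Up to sign the inverse of \<open>row_coeff\<close> at the starting times, which are
  \<open>t = 0\<close> for even rows and \<open>t = -1\<close> for odd ones.\<close>

definition weight :: "nat \<Rightarrow> (nat \<Rightarrow> 'a::field) \<Rightarrow> nat \<Rightarrow> 'a" where
  "weight r x n =
     (if even n then wave r x (int n) / wave r x (int n + 1)
      else wave r x (int n + 1) / wave r x (int n))"

definition row_coeff :: "nat \<Rightarrow> (nat \<Rightarrow> 'a::field) \<Rightarrow> int \<Rightarrow> int \<Rightarrow> 'a" where
  "row_coeff r x i t = period4_sign t * wave r x (i + t + 1) / wave r x (i - t)"

text \<open>For \<open>0 \<le> i \<le> r\<close>, \<open>0 \<le> t \<le> r + 1\<close> and \<open>0 \<le> n \<le> r\<close> this is the indicator function of
  \<open>max (i - t) (t - i - 1) \<le> n \<le> min (i + t) (2 * r + 1 - i - t)\<close>. Written as a sum of step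
  functions of \<open>i + t\<close> and of \<open>i - t\<close> it visibly satisfies the wave equation; it takes the value
  \<open>- 1\<close> at \<open>t = - 1\<close>, \<open>n = i\<close>.\<close>

definition row_support :: "nat \<Rightarrow> int \<Rightarrow> int \<Rightarrow> int \<Rightarrow> int" where
  "row_support r i t n =
     1 - of_bool (n < i - t) - of_bool (n > i + t)
       - of_bool (n < t - i - 1) - of_bool (n > 2 * int r + 1 - i - t)"

definition row_entry :: "nat \<Rightarrow> (nat \<Rightarrow> 'a::field) \<Rightarrow> int \<Rightarrow> int \<Rightarrow> nat \<Rightarrow> 'a" where
  "row_entry r x i t n = row_coeff r x i t * weight r x n * of_int (row_support r i t (int n))"

lemma row_support_rec:
  "row_support r i (l + 1) n
     = row_support r (i - 1) l n - row_support r i (l - 1) n + row_support r (i + 1) l n"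
  by (simp add: row_support_def algebra_simps)

text \<open>At \<open>i = -1\<close> the conditions \<open>n > i + t\<close> and
  \<open>n < t - i - 1\<close> are complementary and the other two void; the right end is the mirror
  image. Thus the recurrence also covers the first and the last row.\<close>

lemma row_support_left:
  "0 \<le> n \<Longrightarrow> n \<le> int r \<Longrightarrow> l \<le> int r + 1 \<Longrightarrow> 0 \<le> l \<Longrightarrow> row_support r (- 1) l n = 0"
  by (auto simp: row_support_def)

lemma row_support_right:
  "0 \<le> n \<Longrightarrow> n \<le> int r \<Longrightarrow> l \<le> int r + 1 \<Longrightarrow> 0 \<le> l \<Longrightarrow> row_support r (int r + 1) l n = 0"
  by (auto simp: row_support_def)

section \<open>Layers as row operations\<close>

lemma id_with_block_mult_index:
  assumes "Q \<in> carrier_mat (r + 1) c" "1 \<le> k" "k \<le> r" "i \<le> r" "n < c"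
  shows "(id_with_block r k p q s t * Q) $$ (i, n) =
    (if i = k - 1 then p * Q $$ (k - 1, n) + q * Q $$ (k, n)
     else if i = k then s * Q $$ (k - 1, n) + t * Q $$ (k, n)
     else Q $$ (i, n))"
proof -
  have "(id_with_block r k p q s t * Q) $$ (i, n)
      = (\<Sum>m\<in>{0..<r+1}. id_with_block r k p q s t $$ (i, m) * Q $$ (m, n))"
    using assms by (simp add: scalar_prod_def id_with_block_def)
  also have "\<dots> = (\<Sum>m\<in>{0..<r+1}.
      (if m = k - 1 then (if i = k - 1 then p else if i = k then s else 0) * Q $$ (m, n) else 0)
      + (if m = k then (if i = k - 1 then q else if i = k then t else 0) * Q $$ (m, n) else 0)
      + (if m = i then (if i = k - 1 \<or> i = k then 0 else 1) * Q $$ (m, n) else 0))"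
    using assms by (intro sum.cong) (auto simp: id_with_block_def)
  also have "\<dots> = (if i = k - 1 then p * Q $$ (k - 1, n) + q * Q $$ (k, n)
     else if i = k then s * Q $$ (k - 1, n) + t * Q $$ (k, n)
     else Q $$ (i, n))"
    using assms by (auto simp: sum.distrib)
  finally show ?thesis .
qed

lemma ordered_prod_Cons [simp]: "ordered_prod n (M # Ms) = M * ordered_prod n Ms"
  and ordered_prod_Nil [simp]: "ordered_prod n [] = 1\<^sub>m n"
  by (simp_all add: ordered_prod_def)

lemma ordered_prod_carrier:
  "(\<And>M. M \<in> set Ms \<Longrightarrow> M \<in> carrier_mat n n) \<Longrightarrow> ordered_prod n Ms \<in> carrier_mat n n"
  by (induction Ms) (auto intro!: mult_carrier_mat)

lemma N_mat_carrier: "N_mat r x i l \<in> carrier_mat (r + 1) (r + 1)"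
  by (simp add: N_mat_def U_mat_def V_mat_def id_with_block_def)

text \<open>The variable start \<open>k\<close> allows induction on the factors from right to left,
  the order in which they act on a matrix to their right.\<close>

definition layer :: "nat \<Rightarrow> (nat \<Rightarrow> 'a::field) \<Rightarrow> nat \<Rightarrow> nat \<Rightarrow> 'a mat" where
  "layer r x l k = ordered_prod (r + 1) (map (\<lambda>i. N_mat r x i l) [k..<r + 1])"

lemma layer_carrier: "layer r x l k \<in> carrier_mat (r + 1) (r + 1)"
  unfolding layer_def by (rule ordered_prod_carrier) (use N_mat_carrier in auto)

lemma layer_rec: "k \<le> r \<Longrightarrow> layer r x l k = N_mat r x k l * layer r x l (Suc k)"
  by (simp add: layer_def upt_conv_Cons del: upt_Suc)

lemma layer_end: "layer r x l (Suc r) = 1\<^sub>m (r + 1)"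
  by (simp add: layer_def)

lemma P_mat_0: "P_mat r x 0 = 1\<^sub>m (r + 1)"
  by (simp add: P_mat_def)

lemma P_mat_Suc: "P_mat r x (Suc j) = layer r x j 1 * P_mat r x j"
  by (simp add: P_mat_def layer_def)

lemma P_mat_carrier: "P_mat r x j \<in> carrier_mat (r + 1) (r + 1)"
proof (induction j)
  case (Suc j)
  then show ?case unfolding P_mat_Suc by (rule mult_carrier_mat[OF layer_carrier])
qed (simp add: P_mat_0)

text \<open>A \<open>V_mat\<close> factor with index \<open>k\<close> alters only row
  \<open>k - 1\<close>, a \<open>U_mat\<close> factor only row \<open>k\<close>. So a row with
  \<open>i + l\<close> odd meets first factor \<open>i + 1\<close>, giving \<open>v i\<close>, then
  factor \<open>i\<close>; the neighbouring rows they read never change.\<close>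

lemma layer_mult_index:
  fixes x :: "nat \<Rightarrow> 'a::field"
  assumes Q: "Q \<in> carrier_mat (r + 1) (r + 1)" and n: "n \<le> r"
    and q: "\<And>i. i \<le> r \<Longrightarrow> q i = Q $$ (i, n)" and q_end: "q (Suc r) = 0"
    and v: "\<And>i. v i = (array r x (i + 1) (l + 1) * q i + array r x i l * q (i + 1)) / array r x (i + 1) l"
    and k: "1 \<le> k" "k \<le> Suc r"
  shows "\<forall>i\<le>r. (layer r x l k * Q) $$ (i, n) =
    (if even (i + l) \<or> Suc i < k then q i
     else if Suc i = k then v i
     else (array r x (i + 1) (l + 1) * q (i - 1) + array r x i (l + 1) * v i) / array r x i l)"
  using k(2) k(1)
proof (induction k rule: inc_induct)
  case base
  \<comment> \<open>There is no factor \<open>r + 1\<close>: \<open>q (Suc r) = 0\<close> and the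
    boundary value \<open>1\<close> of the array give \<open>v r = q r\<close>.\<close>
  then show ?case using Q n q q_end by (auto simp: layer_end v array_boundary)
next
  case (step k)
  then obtain k' where k': "k = Suc k'" "k' < r" by (cases k) auto
  then have kr: "k \<le> r" "1 \<le> k" by auto
  let ?L = "layer r x l (Suc k) * Q"
  have L: "?L \<in> carrier_mat (r + 1) (r + 1)" by (rule mult_carrier_mat[OF layer_carrier Q])
  have eq: "layer r x l k * Q = N_mat r x k l * ?L"
    unfolding layer_rec[OF kr(1)] by (rule assoc_mult_mat[OF N_mat_carrier layer_carrier Q])
  have IH: "?L $$ (i, n) =
    (if even (i + l) \<or> i < k then q i
     else if i = k then v i
     else (array r x (i + 1) (l + 1) * q (i - 1) + array r x i (l + 1) * v i) / array r x i l)"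
    if "i \<le> r" for i
    using step.IH that by simp
  have n': "n < r + 1" using n by simp
  show ?case
  proof (intro allI impI)
    fix i assume i: "i \<le> r"
    show "(layer r x l k * Q) $$ (i, n) =
      (if even (i + l) \<or> Suc i < k then q i
       else if Suc i = k then v i
       else (array r x (i + 1) (l + 1) * q (i - 1) + array r x i (l + 1) * v i) / array r x i l)"
    proof (cases "odd (k + l)")
      case True
      then have N: "N_mat r x k l = id_with_block r k 1 0
          (array r x (k + 1) (l + 1) / array r x k l) (array r x k (l + 1) / array r x k l)"
        by (simp add: N_mat_def U_mat_def)
      have "(layer r x l k * Q) $$ (i, n) =
        (if i = k then (array r x (k + 1) (l + 1) / array r x k l) * ?L $$ (k - 1, n)
            + (array r x k (l + 1) / array r x k l) * ?L $$ (k, n)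
         else ?L $$ (i, n))"
        unfolding eq N id_with_block_mult_index[OF L kr(2,1) i n'] using k' by auto
      moreover have "?L $$ (k - 1, n) = q (k - 1)" "?L $$ (k, n) = v k"
        using True k' IH[of "k - 1"] IH[of k] by simp_all
      ultimately show ?thesis
        using True i k' IH[OF i] by (auto simp: add_divide_distrib)
    next
      case False
      then have N: "N_mat r x k l = id_with_block r k
          (array r x k (l + 1) / array r x k l) (array r x (k - 1) l / array r x k l) 0 1"
        by (simp add: N_mat_def V_mat_def)
      have "(layer r x l k * Q) $$ (i, n) =
        (if i = k - 1 then (array r x k (l + 1) / array r x k l) * ?L $$ (k - 1, n)
            + (array r x (k - 1) l / array r x k l) * ?L $$ (k, n)
         else ?L $$ (i, n))"
        unfolding eq N id_with_block_mult_index[OF L kr(2,1) i n'] using k' by auto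
      moreover have "?L $$ (k - 1, n) = q (k - 1)" "?L $$ (k, n) = q k"
        using False k' IH[of "k - 1"] IH[of k] by simp_all
      ultimately show ?thesis
        using False i k' IH[OF i] by (auto simp: v add_divide_distrib less_Suc_eq)
    qed
  qed
qed

section \<open>Closed forms for the array and the rows\<close>

context
  fixes r :: nat and x :: "nat \<Rightarrow> 'a::field"
  assumes x_nonzero: "\<And>i. i \<in> {1..r} \<Longrightarrow> x i \<noteq> 0"
begin

lemma skip_prod_nonzero: "m \<le> r + 1 \<Longrightarrow> skip_prod x m \<noteq> 0"
  using x_nonzero by (induction x m rule: skip_prod.induct) auto

lemma skip_prod_quotient:
  assumes "p \<le> q" "even (p + q)" "q \<le> r + 1"
  shows "skip_prod x q / skip_prod x p = (\<Prod>s \<in> {s \<in> {p<..<q}. odd (p + s)}. x s)"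
proof -
  define d where "d = (q - p) div 2"
  have q: "q = p + 2 * d" using assms(1,2) by (auto simp: d_def)
  have "skip_prod x q / skip_prod x p = (\<Prod>k<d. x (p + 2 * k + 1))"
    using skip_prod_nonzero[of p] assms by (simp add: q skip_prod_add)
  also have "\<dots> = (\<Prod>s \<in> {s \<in> {p<..<q}. odd (p + s)}. x s)"
  proof (rule prod.reindex_bij_witness[where j = "\<lambda>k. p + 2 * k + 1" and i = "\<lambda>s. (s - p) div 2"])
    fix s assume "s \<in> {s \<in> {p<..<q}. odd (p + s)}"
    then have "p < s" "s < p + 2 * d" "odd (p + s)" by (auto simp: q)
    then show "p + 2 * ((s - p) div 2) + 1 = s" "(s - p) div 2 \<in> {..<d}"
      unfolding lessThan_iff by presburger+
  qed (auto simp: q)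
  finally show ?thesis .
qed

lemma wave_nonzero:
  assumes "- (int r + 1) \<le> m" "m \<le> 2 * (int r + 1)"
  shows "wave r x m \<noteq> 0"
  using assms by (auto simp: wave_def skip_prod_nonzero nat_le_iff)

text \<open>In the relation both products contain the same four values of \<open>wave\<close>; their
  signs are \<open>1\<close> and \<open>-1\<close>, since \<open>period4_sign\<close> changes sign
  under a shift by 2. Uniqueness of the array does the rest.\<close>

lemma array_eq_wave:
  assumes "i \<le> r + 1" "j \<le> r + 1"
  shows "array r x i j = period4_sign (int j) * wave r x (int i + int j) / wave r x (int i - int j)"
proof (rule array_unique[symmetric, OF x_nonzero _ _ _ _ assms])
  fix i :: nat assume "i \<le> r + 1"
  then show "period4_sign (int 0) * wave r x (int i + int 0) / wave r x (int i - int 0) = 1"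
    using wave_nonzero[of "int i"] by simp
next
  fix j :: nat assume "j \<le> r + 1"
  then show "period4_sign (int j) * wave r x (int 0 + int j) / wave r x (int 0 - int j) = 1
    \<and> period4_sign (int j) * wave r x (int (r + 1) + int j) / wave r x (int (r + 1) - int j) = 1"
    by (auto simp: wave_def skip_prod_nonzero nat_le_iff add_diff_eq mult.assoc[symmetric])
next
  fix i assume "i \<in> {1..r}"
  moreover from this obtain k where "i = Suc k" by (cases i) auto
  ultimately show "period4_sign (int 1) * wave r x (int i + int 1) / wave r x (int i - int 1) = x i"
    using skip_prod_nonzero[of k] by (auto simp: wave_def nat_add_distrib)
next
  fix i j assume ij: "i \<in> {1..r}" "j \<in> {1..r}"
  have s: "period4_sign (int j - 1) = - (period4_sign (1 + int j) :: 'a)"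
    using period4_sign_plus_1[of "int j", where 'a = 'a] by (simp add: add.commute)
  show "period4_sign (int j) * wave r x (int (i - 1) + int j) / wave r x (int (i - 1) - int j) *
     (period4_sign (int j) * wave r x (int (i + 1) + int j) / wave r x (int (i + 1) - int j)) +
     period4_sign (int (j + 1)) * wave r x (int i + int (j + 1)) / wave r x (int i - int (j + 1)) *
     (period4_sign (int (j - 1)) * wave r x (int i + int (j - 1)) / wave r x (int i - int (j - 1))) = 0"
    using ij by (simp add: s algebra_simps)
qed

lemma row_entry_left: "n \<le> r \<Longrightarrow> 0 \<le> l \<Longrightarrow> l \<le> int r + 1 \<Longrightarrow> row_entry r x (- 1) l n = 0"
  by (simp add: row_entry_def row_support_left)

lemma row_entry_right: "n \<le> r \<Longrightarrow> 0 \<le> l \<Longrightarrow> l \<le> int r + 1 \<Longrightarrow> row_entry r x (int r + 1) l n = 0"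
  by (simp add: row_entry_def row_support_right)

lemma row_entry_rec:
  assumes "i \<le> r" "l \<le> r"
  shows "row_entry r x (int i) (int l + 1) n =
    (array r x (i + 1) (l + 1) * row_entry r x (int i - 1) (int l) n
     + array r x i (l + 1) * ((array r x (i + 1) (l + 1) * row_entry r x (int i) (int l - 1) n
         + array r x i l * row_entry r x (int i + 1) (int l) n) / array r x (i + 1) l))
      / array r x i l"
proof -
  let ?c = "row_coeff r x (int i) (int l + 1)"
  define a where "a = array r x i l"
  define a' where "a' = array r x (i + 1) l"
  define b where "b = array r x i (l + 1)"
  define b' where "b' = array r x (i + 1) (l + 1)"
  define \<sigma> :: 'a where "\<sigma> = period4_sign (int l)"
  define \<tau> :: 'a where "\<tau> = period4_sign (int l + 1)"
  \<comment> \<open>\<open>F\<close> and \<open>G\<close> follow the characteristics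
    \<open>i + l\<close> and \<open>i - l\<close>, which makes the cancellations in the three
    coefficients visible.\<close>
  define F where "F m = wave r x (int i + int l + m)" for m
  define G where "G m = wave r x (int i - int l + m)" for m
  have eqs: "a = \<sigma> * F 0 / G 0" "a' = \<sigma> * F 1 / G 1" "b = \<tau> * F 1 / G (- 1)" "b' = \<tau> * F 2 / G 0"
    "row_coeff r x (int i - 1) (int l) = \<sigma> * F 0 / G (- 1)"
    "row_coeff r x (int i) (int l - 1) = - \<tau> * F 0 / G 1"
    "row_coeff r x (int i + 1) (int l) = \<sigma> * F 2 / G 1"
    "?c = \<tau> * F 2 / G (- 1)"
    using assms period4_sign_plus_1[of "int l", where 'a = 'a]
    by (simp_all add: a_def a'_def b_def b'_def array_eq_wave row_coeff_def \<sigma>_def \<tau>_def F_def G_def algebra_simps)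
  have nz: "F 0 \<noteq> 0" "F 1 \<noteq> 0" "F 2 \<noteq> 0" "G 0 \<noteq> 0" "G 1 \<noteq> 0" "G (- 1) \<noteq> 0"
    unfolding F_def G_def by (rule wave_nonzero; use assms in simp)+
  have signs: "\<sigma> * \<sigma> = 1" "\<tau> * \<tau> = 1" "\<sigma> \<noteq> 0" by (simp_all add: \<sigma>_def \<tau>_def)
  have alpha: "b' / a * row_coeff r x (int i - 1) (int l) = ?c"
    using nz signs by (simp add: eqs)
  have "b * b' / (a * a') * row_coeff r x (int i) (int l - 1) = - (\<tau> * \<tau>) / (\<sigma> * \<sigma>) * ?c"
    unfolding eqs using nz signs(3) by (simp add: divide_simps)
  then have beta: "b * b' / (a * a') * row_coeff r x (int i) (int l - 1) = - ?c"
    by (simp add: signs)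
  have gamma: "b / a' * row_coeff r x (int i + 1) (int l) = ?c"
    using nz signs by (simp add: eqs)
  have a: "a \<noteq> 0" "a' \<noteq> 0"
    unfolding a_def a'_def by (rule array_nonzero[OF x_nonzero], assumption)+
  have "row_entry r x (int i) (int l + 1) n =
      ?c * weight r x n * of_int (row_support r (int i - 1) (int l) (int n))
      + - ?c * weight r x n * of_int (row_support r (int i) (int l - 1) (int n))
      + ?c * weight r x n * of_int (row_support r (int i + 1) (int l) (int n))"
    unfolding row_entry_def row_support_rec by (simp add: algebra_simps)
  also have "\<dots> = b' / a * row_entry r x (int i - 1) (int l) n
     + b * b' / (a * a') * row_entry r x (int i) (int l - 1) n
     + b / a' * row_entry r x (int i + 1) (int l) n"
    \<comment> \<open>The third \<open>?c\<close> is rewritten first, so that \<open>beta\<close>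
      meets the negated one and \<open>alpha\<close> the only one left.\<close>
    by (subst (3) gamma[symmetric], subst beta[symmetric], subst alpha[symmetric])
      (simp only: row_entry_def mult.assoc)
  also have "\<dots> = (b' * row_entry r x (int i - 1) (int l) n
     + b * ((b' * row_entry r x (int i) (int l - 1) n
         + a * row_entry r x (int i + 1) (int l) n) / a')) / a"
    using a by (simp add: field_simps)
  finally show ?thesis unfolding a_def a'_def b_def b'_def .
qed

text \<open>Layer \<open>l\<close> brings the rows with \<open>i + l\<close> odd to time
  \<open>l + 1\<close>. Hence row \<open>i\<close> stands at the largest time
  \<open>t \<le> j\<close> with \<open>i + t\<close> even.\<close>

lemma P_mat_index:
  assumes "j \<le> r + 1" "i \<le> r" "n \<le> r"
  shows "P_mat r x j $$ (i, n) =
    row_entry r x (int i) (if even (i + j) then int j else int j - 1) n"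
  using assms
proof (induction j arbitrary: i)
  case 0
  \<comment> \<open>Odd rows start at time \<open>-1\<close>, where the support and
    \<open>period4_sign\<close> both contribute \<open>-1\<close> on the diagonal.\<close>
  have "row_support r (int i) 0 (int n) = of_bool (i = n)"
    "row_support r (int i) (- 1) (int n) = - of_bool (i = n)"
    using 0 by (auto simp: row_support_def)
  moreover have "period4_sign (- 1) = (- 1 :: 'a)" by (simp add: period4_sign_def)
  moreover have "wave r x (int i) \<noteq> 0" "wave r x (int i + 1) \<noteq> 0"
    by (rule wave_nonzero; use 0 in simp)+
  ultimately show ?case
    using 0 by (auto simp: P_mat_0 row_entry_def row_coeff_def weight_def)
next
  case (Suc j)
  define q where "q i = (if i = Suc r then 0 else P_mat r x j $$ (i, n))" for i
  define v where "v i = (array r x (i + 1) (j + 1) * q i + array r x i j * q (i + 1)) / array r x (i + 1) j" for i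
  have q: "q k = row_entry r x (int k) (if even (k + j) then int j else int j - 1) n" if "k \<le> r" for k
    using that Suc by (simp add: q_def)
  have P: "P_mat r x (Suc j) $$ (i, n) =
    (if even (i + j) then q i
     else if i = 0 then v i
     else (array r x (i + 1) (j + 1) * q (i - 1) + array r x i (j + 1) * v i) / array r x i j)"
    using layer_mult_index[where q = q and v = v and l = j and k = 1 and n = n, OF P_mat_carrier[of r x j]] Suc.prems
    by (simp add: P_mat_Suc q_def v_def)
  show ?case
  proof (cases "even (i + j)")
    case True
    then show ?thesis using P q Suc.prems by simp
  next
    case False
    have q1: "q (i + 1) = row_entry r x (int i + 1) (int j) n"
      using False q[of "i + 1"] Suc.prems row_entry_right[of n "int j"] by (cases "i = r") (auto simp: q_def add_ac)
    have q0: "(if i = 0 then 0 else q (i - 1)) = row_entry r x (int i - 1) (int j) n"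
      using False q[of "i - 1"] Suc.prems row_entry_left[of n "int j"] by (auto)
    \<comment> \<open>For \<open>i = 0\<close> the padding by \<open>0\<close> and the boundary
      value \<open>1\<close> of the array reduce this formula to \<open>v 0\<close>.\<close>
    have "P_mat r x (Suc j) $$ (i, n) =
      (array r x (i + 1) (j + 1) * (if i = 0 then 0 else q (i - 1)) + array r x i (j + 1) * v i) / array r x i j"
      using False P by (auto simp: array_boundary)
    also have "\<dots> = row_entry r x (int i) (int j + 1) n"
      unfolding q0 v_def q1 using False q[of i] Suc.prems by (simp add: row_entry_rec)
    finally show ?thesis using False by (simp add: add.commute)
  qed
qed

end

section \<open>Entries as signed squarefree monomials\<close>

text \<open>On the support two quotients of \<open>skip_prod\<close> telescope, one to even and one
  to odd indices, so their product is squarefree. As \<open>e\<close> and \<open>S\<close> precede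
  \<open>x\<close>, one monomial serves all points, as the limit requires.\<close>

lemma row_entry_monomial:
  assumes i: "i \<le> r" and n: "n \<le> r" and t: "t \<le> r + 1" and parity: "even (i + t)"
  shows "\<exists>e :: int. \<exists>S\<subseteq>{1..r}. \<forall>x :: nat \<Rightarrow> 'a::field. (\<forall>i\<in>{1..r}. x i \<noteq> 0) \<longrightarrow>
    row_entry r x (int i) (int t) n = of_int e * prod x S"
proof (cases "row_support r (int i) (int t) (int n) = 0")
  case True
  then show ?thesis by (intro exI[of _ 0] exI[of _ "{}"]) (simp add: row_entry_def)
next
  case False
  then have supp: "row_support r (int i) (int t) (int n) = 1"
    and bounds: "i \<le> n + t" "n \<le> i + t" "t \<le> n + i + 1" "n + i + t \<le> 2 * r + 1"
    using i n t by (auto simp: row_support_def of_bool_def split: if_splits)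
  define p where "p = (if t \<le> i then i - t else t - i)"
  define q where "q = (if i + t \<le> r then i + t + 1 else 2 * r + 1 - i - t)"
  define u where "u = (if even n then n + 1 else n)"
  define z where "z = (if even n then n else n + 1)"
  define e1 :: int where "e1 = (if i + t \<le> r then 1 else period4_sign (int i + int t - int r))"
  define e2 :: int where "e2 = (if t \<le> i then 1 else period4_sign (int t - int i))"
  define S where "S = {s \<in> {u<..<q}. odd (u + s)}"
  define T where "T = {s \<in> {p<..<z}. odd (p + s)}"
  have par: "even p" "odd q" "odd u" "even z"
    using parity bounds by (auto simp: p_def q_def u_def z_def)
  \<comment> \<open>Parity sharpens these bounds: \<open>z\<close> and \<open>u\<close> are the even
    and the odd one of \<open>n\<close>, \<open>n + 1\<close>, while \<open>p\<close> is even and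
    \<open>q\<close> odd.\<close>
  have "p \<le> n + 1" "n \<le> q" using bounds by (auto simp: p_def q_def)
  then have "p \<le> z" "u \<le> q"
    using par by (auto simp: z_def u_def le_Suc_eq Suc_le_eq le_less)
  then have pz: "p \<le> z" "even (p + z)" "z \<le> r + 1" and uq: "u \<le> q" "even (u + q)" "q \<le> r + 1"
    using par n by (auto simp: z_def q_def)
  show ?thesis
  proof (intro exI conjI allI impI)
    show "S \<union> T \<subseteq> {1..r}" using pz uq by (auto simp: S_def T_def)
    have disj: "S \<inter> T = {}" using par by (auto simp: S_def T_def)
    fix x :: "nat \<Rightarrow> 'a" assume "\<forall>i\<in>{1..r}. x i \<noteq> 0"
    then have nz: "x i \<noteq> 0" if "i \<in> {1..r}" for i using that by blast
    have "nat (2 * (int r + 1) - (int i + int t + 1)) = 2 * r + 1 - i - t" "nat (int i + int t + 1) = i + t + 1"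
      by simp_all
    then have "wave r x (int i + int t + 1) = of_int e1 * skip_prod x q"
      by (auto simp: wave_def q_def e1_def)
    moreover have "wave r x (int i - int t) = of_int e2 * skip_prod x p"
      using bounds i by (auto simp: wave_def p_def e2_def nat_diff_distrib)
    moreover have "weight r x n = skip_prod x z / skip_prod x u"
      using n by (auto simp: weight_def wave_def z_def u_def nat_add_distrib)
    ultimately have "row_entry r x (int i) (int t) n = period4_sign (int t) * of_int e1 / of_int e2
        * (skip_prod x q / skip_prod x u) * (skip_prod x z / skip_prod x p)"
      by (simp add: row_entry_def row_coeff_def supp mult_ac)
    also have "\<dots> = period4_sign (int t) * of_int e1 / of_int e2 * prod x S * prod x T"
      unfolding S_def T_def by (simp only: skip_prod_quotient[OF nz pz] skip_prod_quotient[OF nz uq])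
    also have "\<dots> = of_int (period4_sign (int t) * e1 * e2) * prod x (S \<union> T)"
      using disj by (simp add: prod.union_disjoint S_def T_def e2_def period4_sign_def)
    finally show "row_entry r x (int i) (int t) n
        = of_int (period4_sign (int t) * e1 * e2) * prod x (S \<union> T)" .
  qed
qed

lemma P_mat_monomial:
  assumes "j \<le> r + 1" "i \<le> r" "n \<le> r"
  shows "\<exists>e :: int. \<exists>S\<subseteq>{1..r}. \<forall>x :: nat \<Rightarrow> 'a::field. (\<forall>i\<in>{1..r}. x i \<noteq> 0) \<longrightarrow>
    P_mat r x j $$ (i, n) = of_int e * prod x S"
proof (cases j)
  \<comment> \<open>Odd rows have time \<open>-1\<close> here, which the natural number
    \<open>t\<close> of \<open>row_entry_monomial\<close> cannot express.\<close>
  case 0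
  then show ?thesis
    using assms by (intro exI[of _ "of_bool (i = n)"] exI[of _ "{}"]) (simp add: P_mat_0)
next
  case (Suc k)
  define t where "t = (if even (i + j) then j else k)"
  have t: "int t = (if even (i + j) then int j else int j - 1)" "even (i + t)" "t \<le> r + 1"
    using Suc assms by (auto simp: t_def)
  obtain e S where S: "S \<subseteq> {1..r}" and eq: "\<forall>x :: nat \<Rightarrow> 'a. (\<forall>i\<in>{1..r}. x i \<noteq> 0) \<longrightarrow>
      row_entry r x (int i) (int t) n = of_int e * prod x S"
    using row_entry_monomial[OF assms(2,3) t(3,2), where 'a = 'a] by blast
  have "P_mat r x j $$ (i, n) = of_int e * prod x S" if "\<forall>i\<in>{1..r}. x i \<noteq> 0" for x :: "nat \<Rightarrow> 'a"
    using P_mat_index[OF _ assms, of x] eq that unfolding t(1) by simp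
  with S show ?thesis by blast
qed

section \<open>Polynomials among the rational functions\<close>

lemma to_fract_of_nat: "to_fract (of_nat k) = of_nat k"
  by (induction k) simp_all

lemma to_fract_of_int: "to_fract (of_int k) = of_int k"
  by (cases k rule: int_cases2) (simp_all add: to_fract_of_nat)

lemma polynomials_in_of_int: "of_int k \<in> polynomials_in I"
proof -
  have "Poly_Mapping.keys m \<subseteq> I" if "m \<in> Poly_Mapping.keys (of_int k :: 'a mpol)" for m
    using that by (auto simp: in_keys_iff lookup_of_int when_def split: if_splits)
  then show ?thesis unfolding polynomials_in_def to_fract_of_int[symmetric] by blast
qed

lemma polynomials_in_indet: "i \<in> I \<Longrightarrow> indet i \<in> polynomials_in I"
  by (auto simp: polynomials_in_def indet_def)

lemma polynomials_in_mult:
  assumes "a \<in> polynomials_in I" "b \<in> polynomials_in I"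
  shows "a * b \<in> polynomials_in I"
proof -
  obtain p q where pq: "a = to_fract p" "b = to_fract q"
    "\<forall>m\<in>Poly_Mapping.keys p. Poly_Mapping.keys m \<subseteq> I" "\<forall>m\<in>Poly_Mapping.keys q. Poly_Mapping.keys m \<subseteq> I"
    using assms by (auto simp: polynomials_in_def)
  have "Poly_Mapping.keys m \<subseteq> I" if "m \<in> Poly_Mapping.keys (p * q)" for m
  proof -
    obtain k l where "m = k + l" "k \<in> Poly_Mapping.keys p" "l \<in> Poly_Mapping.keys q"
      using \<open>m \<in> Poly_Mapping.keys (p * q)\<close> keys_mult[of p q] by blast
    then show ?thesis using pq(3,4) keys_add[of k l] by blast
  qed
  moreover have "a * b = to_fract (p * q)" using pq by simp
  ultimately show ?thesis unfolding polynomials_in_def by blast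
qed

lemma polynomials_in_prod:
  assumes "\<And>s. s \<in> S \<Longrightarrow> f s \<in> polynomials_in I"
  shows "prod f S \<in> polynomials_in I"
  using assms
  by (induction S rule: infinite_finite_induct)
    (use polynomials_in_of_int[of 1] in \<open>auto intro: polynomials_in_mult\<close>)

section \<open>The limit at the origin\<close>

text \<open>Needed for uniqueness of the limit: the diagonal approaches the origin through points
  with nonzero coordinates, and \<open>0\<close> is not isolated in \<open>'l\<close>.\<close>

lemma at_zero_within_nonzero_coordinates:
  "at (\<lambda>_. 0 :: 'l::real_normed_field) within {x :: nat \<Rightarrow> 'l. \<forall>i\<in>{1..r}. x i \<noteq> 0} \<noteq> bot"
proof
  let ?S = "{x :: nat \<Rightarrow> 'l. \<forall>i\<in>{1..r}. x i \<noteq> 0}"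
  assume bot: "at (\<lambda>_. 0 :: 'l) within ?S = bot"
  have "continuous_on UNIV (\<lambda>c :: 'l. (\<lambda>_ :: nat. c))"
    by (intro continuous_on_coordinatewise_then_product continuous_on_id)
  then have "((\<lambda>c :: 'l. (\<lambda>_ :: nat. c)) \<longlongrightarrow> (\<lambda>_. 0)) (at 0)"
    by (simp add: continuous_on_def)
  moreover have "eventually (\<lambda>c :: 'l. (\<lambda>_ :: nat. c) \<in> ?S \<and> (\<lambda>_ :: nat. c) \<noteq> (\<lambda>_. 0)) (at 0)"
    by (auto simp: eventually_at_filter fun_eq_iff)
  ultimately have "filterlim (\<lambda>c :: 'l. (\<lambda>_ :: nat. c)) (at (\<lambda>_. 0) within ?S) (at 0)"
    by (auto simp: filterlim_at elim: eventually_mono)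
  then have "at (0 :: 'l) = bot"
    unfolding bot by (simp add: filterlim_def bot.extremum_unique filtermap_bot_iff)
  then show False by simp
qed

lemma tendsto_coordinate: "((\<lambda>x :: 'i \<Rightarrow> 'b::topological_space. x s) \<longlongrightarrow> a s) (at a within A)"
  using continuous_on_product_coordinates[of s]
  by (auto simp: continuous_on_def intro: tendsto_within_subset)

theorem theorem5p14:
  fixes r j :: nat
  assumes "r \<ge> 1" and "j \<le> r + 1"
  shows
    "(\<forall>m<r + 1. \<forall>n<r + 1.
        P_mat r (indet :: nat \<Rightarrow> 'k::field ratfun) j $$ (m, n) \<in> polynomials_in {1..r})
     \<and> (\<exists>!L. L \<in> carrier_mat (r + 1) (r + 1)
          \<and> (\<forall>m<r + 1. \<forall>n<r + 1.
               ((\<lambda>x :: nat \<Rightarrow> 'l::real_normed_field. P_mat r x j $$ (m, n)) \<longlongrightarrow> L $$ (m, n))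
                 (at (\<lambda>_. 0) within {x. \<forall>i\<in>{1..r}. x i \<noteq> 0})))"
proof
  show "\<forall>m<r + 1. \<forall>n<r + 1.
      P_mat r (indet :: nat \<Rightarrow> 'k ratfun) j $$ (m, n) \<in> polynomials_in {1..r}"
  proof (intro allI impI)
    fix m n assume "m < r + 1" "n < r + 1"
    then have mn: "m \<le> r" "n \<le> r" by auto
    obtain e S where "S \<subseteq> {1..r}"
      "P_mat r (indet :: nat \<Rightarrow> 'k ratfun) j $$ (m, n) = of_int e * prod indet S"
      using P_mat_monomial[OF assms(2) mn, where 'a = "'k ratfun"] indet_nonzero by blast
    then show "P_mat r (indet :: nat \<Rightarrow> 'k ratfun) j $$ (m, n) \<in> polynomials_in {1..r}"
      by (auto intro!: polynomials_in_mult polynomials_in_of_int polynomials_in_prod polynomials_in_indet)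
  qed
next
  let ?F = "at (\<lambda>_. 0) within {x :: nat \<Rightarrow> 'l. \<forall>i\<in>{1..r}. x i \<noteq> 0}"
  define c where "c m n = (SOME c. ((\<lambda>x :: nat \<Rightarrow> 'l. P_mat r x j $$ (m, n)) \<longlongrightarrow> c) ?F)" for m n
  have c: "((\<lambda>x :: nat \<Rightarrow> 'l. P_mat r x j $$ (m, n)) \<longlongrightarrow> c m n) ?F"
    if mn: "m < r + 1" "n < r + 1" for m n
  proof -
    have mn': "m \<le> r" "n \<le> r" using mn by auto
    obtain e S where eS: "P_mat r x j $$ (m, n) = of_int e * prod x S"
      if "\<forall>i\<in>{1..r}. x i \<noteq> 0" for x :: "nat \<Rightarrow> 'l"
      using P_mat_monomial[OF assms(2) mn', where 'a = 'l] by blast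
    have "((\<lambda>x. of_int e * prod x S) \<longlongrightarrow> of_int e * (\<Prod>s\<in>S. 0)) ?F"
      by (intro tendsto_intros tendsto_coordinate)
    \<comment> \<open>The monomial formula is known only off the coordinate hyperplanes, which is
      where the filter lives.\<close>
    moreover have "eventually (\<lambda>x. of_int e * prod x S = P_mat r x j $$ (m, n)) ?F"
      by (auto simp: eventually_at_filter eS)
    ultimately have "((\<lambda>x. P_mat r x j $$ (m, n)) \<longlongrightarrow> of_int e * (\<Prod>s\<in>S. 0)) ?F"
      by (rule Lim_transform_eventually)
    then show ?thesis unfolding c_def by (rule someI)
  qed
  show "\<exists>!L. L \<in> carrier_mat (r + 1) (r + 1) \<and> (\<forall>m<r + 1. \<forall>n<r + 1.
      ((\<lambda>x :: nat \<Rightarrow> 'l. P_mat r x j $$ (m, n)) \<longlongrightarrow> L $$ (m, n)) ?F)"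
  proof (rule ex1I[of _ "mat (r + 1) (r + 1) (\<lambda>(m, n). c m n)"])
    fix L assume L: "L \<in> carrier_mat (r + 1) (r + 1) \<and> (\<forall>m<r + 1. \<forall>n<r + 1.
      ((\<lambda>x :: nat \<Rightarrow> 'l. P_mat r x j $$ (m, n)) \<longlongrightarrow> L $$ (m, n)) ?F)"
    have "L $$ (m, n) = c m n" if "m < r + 1" "n < r + 1" for m n
      by (rule tendsto_unique[OF at_zero_within_nonzero_coordinates _ c[OF that]]) (use L that in blast)
    then show "L = mat (r + 1) (r + 1) (\<lambda>(m, n). c m n)"
      using L by (intro eq_matI) auto
  qed (use c in auto)
qed

end
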